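(* Let $P\subset\mathbb{R}^n$ be a $0/1$-polytope, and let $J_0\subseteq[n]$ be the set of coordinates that are constant on $P$, with constant value $p_0\in\{0,1\}^{J_0}$. Then $P$ decomposes uniquely as a Cartesian product of proper indecomposable $0/1$-polytopes. That is, there are a partition $[n]\setminus J_0=J_1\sqcup\cdots\sqcup J_k$ into nonempty sets ($k\ge 0$) and proper indecomposable $0/1$-polytopes $P_i\subset\mathbb{R}^{J_i}$ ($1\le i\le k$) such that $$P=\{p_0\}\times P_1\times\cdots\times P_k$$ under the identification $\mathbb{R}^n=\mathbb{R}^{J_0}\times\mathbb{R}^{J_1}\times\cdots\times\mathbb{R}^{J_k}$, and the collection of pairs $(J_i,P_i)$ is unique up to reordering. In particular, $P$ is either indecomposable or (up to the constant coordinates) a Cartesian product of at least two proper $0/1$-polytopes.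
   Context: $[n]=\{1,\dots,n\}$. Polytopes are nonempty convex polytopes. A polytope $P\subset\mathbb{R}^n$ is a $0/1$-polytope if all its vertices lie in $\{0,1\}^n$ (and similarly in $\mathbb{R}^J$ for a finite set $J$). A polytope is proper if it is not a single point. The Minkowski sum is $Q+R=\{q+r: q\in Q, r\in R\}$. Two polytopes are homothetic if one is obtained from the other by a translation and a dilation with positive factor. A polytope $P$ is (Minkowski) decomposable if there are polytopes $Q,R$ with $P=Q+R$ such that neither $Q$ nor $R$ is homothetic to $P$; otherwise $P$ is indecomposable. *)

theory Defs
  imports "HOL-Analysis.Analysis" "HOL-Library.Set_Algebras"
begin

text \<open>
  The index type \<open>'n\<close> plays the role of \<open>[n]\<close>.  For a set \<open>J\<close> of indices, \<open>\<real>\<^sup>J\<close> is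
  identified with the vectors of \<open>real ^ 'n\<close> that vanish outside \<open>J\<close>; in
  particular \<open>coord_space UNIV = UNIV\<close>.
\<close>

definition coord_space :: "'n::finite set \<Rightarrow> (real ^ 'n) set" where
  "coord_space J = {x. \<forall>i. i \<notin> J \<longrightarrow> x $ i = 0}"

definition coord_proj :: "'n::finite set \<Rightarrow> real ^ 'n \<Rightarrow> real ^ 'n" where
  "coord_proj J x = (\<chi> i. if i \<in> J then x $ i else 0)"

text \<open>The library predicate \<open>polytope\<close> admits the empty set.\<close>

definition polytope_in :: "'n::finite set \<Rightarrow> (real ^ 'n) set \<Rightarrow> bool" where
  "polytope_in J P \<longleftrightarrow> polytope P \<and> P \<noteq> {} \<and> P \<subseteq> coord_space J"

definition zero_one_polytope :: "'n::finite set \<Rightarrow> (real ^ 'n) set \<Rightarrow> bool" where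
  "zero_one_polytope J P \<longleftrightarrow>
     polytope_in J P \<and> (\<forall>v. v extreme_point_of P \<longrightarrow> (\<forall>i\<in>J. v $ i \<in> {0, 1}))"

definition proper :: "(real ^ 'n::finite) set \<Rightarrow> bool" where
  "proper P \<longleftrightarrow> \<not> (\<exists>x. P = {x})"

definition homothetic :: "(real ^ 'n::finite) set \<Rightarrow> (real ^ 'n) set \<Rightarrow> bool" where
  "homothetic Q P \<longleftrightarrow> (\<exists>c t. c > 0 \<and> Q = (\<lambda>x. t + c *\<^sub>R x) ` P)"

text \<open>\<open>Q + R\<close> is the Minkowski sum of sets, from \<open>HOL-Library.Set_Algebras\<close>.\<close>

definition decomposable :: "'n::finite set \<Rightarrow> (real ^ 'n) set \<Rightarrow> bool" where
  "decomposable J P \<longleftrightarrow>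
     (\<exists>Q R. polytope_in J Q \<and> polytope_in J R \<and> P = Q + R \<and>
            \<not> homothetic Q P \<and> \<not> homothetic R P)"

abbreviation indecomposable :: "'n::finite set \<Rightarrow> (real ^ 'n) set \<Rightarrow> bool" where
  "indecomposable J P \<equiv> \<not> decomposable J P"

definition const_coords :: "(real ^ 'n::finite) set \<Rightarrow> 'n set" where
  "const_coords P = {i. \<exists>c. \<forall>x\<in>P. x $ i = c}"

definition nonempty_partition :: "'n set \<Rightarrow> nat \<Rightarrow> (nat \<Rightarrow> 'n set) \<Rightarrow> bool" where
  "nonempty_partition A k J \<longleftrightarrow>
     (\<forall>i\<in>{1..k}. J i \<noteq> {}) \<and> disjoint_family_on J {1..k} \<and> (\<Union>i\<in>{1..k}. J i) = A"

text \<open>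
  \<open>{p0} \<times> P\<^sub>1 \<times> \<dots> \<times> P\<^sub>k\<close>, as a subset of \<open>\<real>\<^sup>n\<close> under the identification
  \<open>\<real>\<^sup>n = \<real>\<^bsup>J0\<^esup> \<times> \<real>\<^bsup>J 1\<^esup> \<times> \<dots> \<times> \<real>\<^bsup>J k\<^esup>\<close>.
\<close>

definition cart_product ::
    "'n::finite set \<Rightarrow> real ^ 'n \<Rightarrow> nat \<Rightarrow> (nat \<Rightarrow> 'n set) \<Rightarrow> (nat \<Rightarrow> (real ^ 'n) set) \<Rightarrow> (real ^ 'n) set" where
  "cart_product J0 p0 k J Q =
     {x. coord_proj J0 x = p0 \<and> (\<forall>i\<in>{1..k}. coord_proj (J i) x \<in> Q i)}"

definition zero_one_product ::
    "(real ^ 'n::finite) set \<Rightarrow> 'n set \<Rightarrow> real ^ 'n \<Rightarrow> nat \<Rightarrow> (nat \<Rightarrow> 'n set) \<Rightarrow> (nat \<Rightarrow> (real ^ 'n) set) \<Rightarrow> bool" where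
  "zero_one_product P J0 p0 k J Q \<longleftrightarrow>
     nonempty_partition (UNIV - J0) k J \<and>
     (\<forall>i\<in>{1..k}. zero_one_polytope (J i) (Q i) \<and> proper (Q i)) \<and>
     P = cart_product J0 p0 k J Q"

definition indecomposable_product ::
    "(real ^ 'n::finite) set \<Rightarrow> 'n set \<Rightarrow> real ^ 'n \<Rightarrow> nat \<Rightarrow> (nat \<Rightarrow> 'n set) \<Rightarrow> (nat \<Rightarrow> (real ^ 'n) set) \<Rightarrow> bool" where
  "indecomposable_product P J0 p0 k J Q \<longleftrightarrow>
     zero_one_product P J0 p0 k J Q \<and> (\<forall>i\<in>{1..k}. indecomposable (J i) (Q i))"

end

theory Submission
  imports Defs
begin

text \<open>
  Let a 0/1-polytope be a Minkowski sum \<open>P = Q + R\<close>.  Write a vertex of \<open>P\<close> as \<open>v = q + r\<close>.  In a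
  nonconstant coordinate \<open>v\<close> has the entry 0 or 1, and this decides whether the entry of \<open>q\<close> is
  minimal or maximal over \<open>Q\<close>.  Hence each entry of \<open>q\<close> is an affine function, with a slope
  in \<open>[0,1]\<close>, of the same entry of \<open>v\<close>, and \<open>Q\<close> is the image of \<open>P\<close> under \<open>x \<mapsto> a + l * x\<close> for a
  vector \<open>l\<close> of slopes, while \<open>R\<close> is the image under \<open>x \<mapsto> (1 - l) * x - a\<close>
  (\<open>summands_diagonal_images\<close>).  If all slopes in nonconstant coordinates agree, \<open>Q\<close> or \<open>R\<close> is
  homothetic to \<open>P\<close>.  So decomposability yields two different slopes, and \<open>P = Q + R\<close> says that
  \<open>l * x + (1 - l) * y\<close> lies in \<open>P\<close> for all \<open>x\<close> and \<open>y\<close> in \<open>P\<close>.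

  The weight vectors \<open>m\<close> with this property are closed under \<open>m * f + (1 - m) * g\<close> and under limits.
  From one that takes different values in two coordinates, one obtains the indicator of a set \<open>E\<close> of
  coordinates that separates the two (\<open>mixes_imp_splits\<close>), and then \<open>P\<close> is the product of its
  projections along \<open>E\<close> and along the complement.  Conversely, such a set \<open>E\<close> exhibits \<open>P\<close> as the sum
  of these two projections, neither of which is homothetic to \<open>P\<close>.  Thus \<open>P\<close> is decomposable if and
  only if some splitting set separates two nonconstant coordinates
  (\<open>decomposable_imp_splits\<close>, \<open>splits_imp_decomposable\<close>).

  The splitting sets form a finite Boolean algebra.  Its atoms, apart from the constant coordinates,
  are the blocks of the decomposition: the projection to a block is indecomposable because a
  splitting set of a factor meets it in a splitting set of \<open>P\<close>, and a decomposition into indecomposable factors must use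
  exactly the blocks because a block strictly inside a factor would decompose it.
\<close>

section \<open>Mixing two points coordinatewise\<close>

text \<open>
  Products of vectors are componentwise, so \<open>m * x + (1 - m) * y\<close> interpolates between \<open>x\<close> and \<open>y\<close>
  with a weight of its own in every coordinate.  Convexity of \<open>P\<close> admits the constant weight vectors
  in \<open>[0,1]\<close>.  That the indicator of \<open>E\<close> is admitted says that \<open>P\<close> is the product of its
  projections to \<open>\<real>\<^sup>E\<close> and to the complementary coordinate space.
\<close>

definition mixes :: "(real ^ 'n::finite) set \<Rightarrow> real ^ 'n \<Rightarrow> bool" where
  "mixes P m \<longleftrightarrow> (\<forall>x\<in>P. \<forall>y\<in>P. m * x + (1 - m) * y \<in> P)"

definition splits :: "(real ^ 'n::finite) set \<Rightarrow> 'n set \<Rightarrow> bool" where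
  "splits P E \<longleftrightarrow> (\<forall>x\<in>P. \<forall>y\<in>P. coord_proj E x + coord_proj (- E) y \<in> P)"

lemma mixes_0: "mixes P 0"
  by (simp add: mixes_def)

lemma mixes_1: "mixes P 1"
  by (simp add: mixes_def)

text \<open>
  Mixing with weight \<open>m\<close> the outcomes of mixing \<open>x\<close> and \<open>y\<close> with the weights \<open>f\<close> and \<open>g\<close>.
\<close>

lemma mixes_combine:
  assumes "mixes P m" "mixes P f" "mixes P g"
  shows "mixes P (m * f + (1 - m) * g)"
  unfolding mixes_def
proof (intro ballI)
  fix x y
  assume "x \<in> P" "y \<in> P"
  then have "m * (f * x + (1 - f) * y) + (1 - m) * (g * x + (1 - g) * y) \<in> P"
    using assms unfolding mixes_def by blast
  then show "(m * f + (1 - m) * g) * x + (1 - (m * f + (1 - m) * g)) * y \<in> P"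
    by (simp add: algebra_simps)
qed

lemma mixes_mult: "mixes P m \<Longrightarrow> mixes P f \<Longrightarrow> mixes P (m * f)"
  using mixes_combine[of P m f 0] mixes_0[of P] by simp

lemma mixes_complement: "mixes P m \<Longrightarrow> mixes P (1 - m)"
  using mixes_combine[of P m 0 1] mixes_0[of P] mixes_1[of P] by simp

lemma mixes_power: "mixes P m \<Longrightarrow> mixes P (m ^ k)"
  by (induction k) (simp_all add: mixes_1 mixes_mult)

lemma power_component: "((m :: real ^ 'n::finite) ^ k) $ i = (m $ i) ^ k"
  by (induction k) simp_all

lemma mixes_limit:
  assumes "closed P" "\<And>k. mixes P (f k)" "f \<longlonglongrightarrow> m"
  shows "mixes P m"
  unfolding mixes_def
proof (intro ballI)
  fix x y
  assume xy: "x \<in> P" "y \<in> P"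
  have "(\<lambda>k. f k * x + (1 - f k) * y) \<longlonglongrightarrow> m * x + (1 - m) * y"
  proof (rule vec_tendstoI)
    fix i
    have "(\<lambda>k. f k $ i) \<longlonglongrightarrow> m $ i"
      using assms(3) by (rule tendsto_vec_nth)
    then show "(\<lambda>k. (f k * x + (1 - f k) * y) $ i) \<longlonglongrightarrow> (m * x + (1 - m) * y) $ i"
      by (auto intro!: tendsto_intros)
  qed
  then show "m * x + (1 - m) * y \<in> P"
    by (rule closed_sequentially[OF assms(1), rotated]) (use assms(2) xy in \<open>auto simp: mixes_def\<close>)
qed

lemma splits_iff_mixes: "splits P E \<longleftrightarrow> mixes P (coord_proj E 1)"
proof -
  have "coord_proj E 1 * x + (1 - coord_proj E 1) * y = coord_proj E x + coord_proj (- E) y" for x y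
    by (simp add: vec_eq_iff coord_proj_def)
  then show ?thesis
    by (simp add: splits_def mixes_def)
qed

text \<open>
  The admissible weights with entries in \<open>[0,1]\<close> form a compact set, so one of them maximizes the
  gap between the entries \<open>i\<close> and \<open>j\<close>.  Let \<open>y\<close> and \<open>x\<close> be these entries of a maximizer \<open>m\<close>; then
  \<open>y > x\<close>.  The weights \<open>m\<^sup>2\<close> and \<open>1 - (1 - m)\<^sup>2\<close> are admissible too and have the gaps
  \<open>(y - x) (x + y)\<close> and \<open>(y - x) (2 - x - y)\<close>, so maximality forces \<open>x + y = 1\<close>.  The weight
  \<open>3 m\<^sup>2 - 2 m\<^sup>3\<close> then has the gap \<open>(y - x) (1 + 2 x y)\<close>, which forces \<open>x y = 0\<close>.
\<close>

lemma mixes_separating_extremal: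
  fixes P :: "(real ^ 'n::finite) set"
  assumes P: "closed P" and l: "mixes P l" "\<forall>i. 0 \<le> l $ i \<and> l $ i \<le> 1" and ij: "l $ j < l $ i"
  obtains m where "mixes P m" "\<forall>i. 0 \<le> m $ i \<and> m $ i \<le> 1" "m $ i = 1" "m $ j = 0"
proof -
  define S where "S = {m. mixes P m \<and> (\<forall>i. 0 \<le> m $ i \<and> m $ i \<le> 1)}"
  have SI: "m \<in> S" if "mixes P m" "\<And>i. 0 \<le> m $ i \<and> m $ i \<le> 1" for m
    using that by (simp add: S_def)
  have S_box: "S = {m. mixes P m} \<inter> cbox 0 1"
    by (auto simp: S_def mem_box_cart)
  have "closed {m. mixes P m}"
    unfolding closed_sequential_limits using mixes_limit[OF P] by simp blast
  then have "compact S"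
    unfolding S_box by (simp add: closed_Int_compact)
  moreover have "l \<in> S"
    using l by (simp add: S_def)
  moreover have "continuous_on S (\<lambda>m. m $ i - m $ j)"
    by (intro continuous_intros)
  ultimately obtain m where mS: "m \<in> S" and max: "\<And>f. f \<in> S \<Longrightarrow> f $ i - f $ j \<le> m $ i - m $ j"
    using continuous_attains_sup[of S "\<lambda>m. m $ i - m $ j"] by blast
  have m: "mixes P m" and m01: "0 \<le> m $ k" "m $ k \<le> 1" for k
    using mS by (auto simp: S_def)
  define x y where "x = m $ j" and "y = m $ i"
  have gap: "0 < y - x"
    using max[OF \<open>l \<in> S\<close>] ij by (simp add: x_def y_def)
  have xy: "0 \<le> x" "x \<le> 1" "0 \<le> y" "y \<le> 1"
    using m01 by (auto simp: x_def y_def)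
  have sq_le: "0 \<le> t * t \<and> t * t \<le> 1" if "0 \<le> t" "t \<le> 1" for t :: real
    using that by (simp add: mult_le_one)
  have "m * m \<in> S"
    by (rule SI) (use m m01 sq_le in \<open>auto intro: mixes_mult\<close>)
  then have "(y - x) * (x + y) \<le> (y - x) * 1"
    using max[of "m * m"] by (simp add: x_def y_def algebra_simps)
  then have le1: "x + y \<le> 1"
    using gap by (simp only: mult_le_cancel_left_pos)
  have m': "mixes P (1 - (1 - m) * (1 - m))"
    using m by (intro mixes_complement mixes_mult)
  have "1 - (1 - m) * (1 - m) \<in> S"
    by (rule SI) (use m' m01 sq_le[of "1 - m $ _"] in auto)
  then have "(y - x) * (2 - x - y) \<le> (y - x) * 1"
    using max[of "1 - (1 - m) * (1 - m)"] by (simp add: x_def y_def algebra_simps)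
  then have "2 - x - y \<le> 1"
    using gap by (simp only: mult_le_cancel_left_pos)
  with le1 have y: "y = 1 - x"
    by simp
  \<comment> \<open>The polynomial \<open>3 t\<^sup>2 - 2 t\<^sup>3\<close>, written so that it is visibly a mixture of mixtures.\<close>
  define f where "f = m * (1 - (1 - m) * (1 - m)) + (1 - m) * (m * m)"
  have "mixes P f"
    unfolding f_def using m m' by (intro mixes_combine mixes_mult)
  moreover have "0 \<le> f $ k \<and> f $ k \<le> 1" for k
  proof -
    have "0 \<le> f $ k"
      using m01[of k] sq_le[of "1 - m $ k"] by (auto simp: f_def intro!: add_nonneg_nonneg mult_nonneg_nonneg)
    moreover have "m $ k * (1 - (1 - m $ k) * (1 - m $ k)) + (1 - m $ k) * (m $ k * m $ k) \<le>
        m $ k * 1 + (1 - m $ k) * 1"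
      using m01[of k] sq_le[of "1 - m $ k"] sq_le[of "m $ k"]
      by (intro add_mono mult_left_mono) auto
    ultimately show ?thesis
      by (simp add: f_def)
  qed
  ultimately have "f \<in> S"
    by (rule SI)
  have fy: "f $ i = y * (1 - (1 - y) * (1 - y)) + (1 - y) * (y * y)"
    and fx: "f $ j = x * (1 - (1 - x) * (1 - x)) + (1 - x) * (x * x)"
    by (simp_all add: f_def x_def y_def)
  have "f $ i - f $ j \<le> y - x"
    using max[OF \<open>f \<in> S\<close>] by (simp add: x_def y_def)
  moreover have "f $ i - f $ j = (y - x) * (1 + 2 * (x * y))"
    unfolding fx fy y by (simp add: algebra_simps)
  ultimately have "(y - x) * (1 + 2 * (x * y)) \<le> (y - x) * 1"
    by simp
  then have "1 + 2 * (x * y) \<le> 1"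
    using gap by (simp only: mult_le_cancel_left_pos)
  then have "x * y = 0"
    using mult_nonneg_nonneg[OF xy(1,3)] by linarith
  then have "x = 0" "y = 1"
    using y gap by auto
  then show ?thesis
    using that[of m] m m01 by (simp add: x_def y_def)
qed

text \<open>
  Powers of a weight vector with entries in \<open>[0,1]\<close> converge to the indicator of the coordinates
  in which the weight is 1.
\<close>

lemma mixes_imp_splits:
  fixes P :: "(real ^ 'n::finite) set"
  assumes "closed P" "mixes P l" "\<forall>i. 0 \<le> l $ i \<and> l $ i \<le> 1" "l $ j < l $ i"
  obtains E where "splits P E" "i \<in> E" "j \<notin> E"
proof -
  obtain m where m: "mixes P m" "\<forall>i. 0 \<le> m $ i \<and> m $ i \<le> 1" "m $ i = 1" "m $ j = 0"
    using mixes_separating_extremal[OF assms] by metis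
  define E where "E = {k. m $ k = 1}"
  have "(\<lambda>k. m ^ k) \<longlonglongrightarrow> coord_proj E 1"
  proof (rule vec_tendstoI)
    fix q
    show "(\<lambda>k. (m ^ k) $ q) \<longlonglongrightarrow> coord_proj E 1 $ q"
    proof (cases "m $ q = 1")
      case True
      then show ?thesis
        by (simp add: power_component coord_proj_def E_def)
    next
      case False
      then have "0 \<le> m $ q" "m $ q < 1"
        using m(2) by (auto simp: less_le)
      then show ?thesis
        using False by (simp add: power_component coord_proj_def E_def LIMSEQ_realpow_zero)
    qed
  qed
  then have "splits P E"
    unfolding splits_iff_mixes using mixes_limit[OF assms(1)] mixes_power[OF m(1)] by blast
  then show ?thesis
    using that m(3,4) by (simp add: E_def)
qed

lemma splits_Compl: "splits P E \<Longrightarrow> splits P (- E)"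
  by (simp add: splits_def add.commute)

lemma splits_Int:
  assumes "splits P E" "splits P F"
  shows "splits P (E \<inter> F)"
proof -
  have "coord_proj (E \<inter> F) 1 = coord_proj E 1 * coord_proj F (1 :: real ^ 'a)"
    by (simp add: vec_eq_iff coord_proj_def)
  then show ?thesis
    using assms by (simp add: splits_iff_mixes mixes_mult)
qed

lemma splits_UNIV: "splits P UNIV"
  by (simp add: splits_def coord_proj_def flip: zero_vec_def)

lemma splits_Inter:
  assumes "finite A" "\<And>E. E \<in> A \<Longrightarrow> splits P E"
  shows "splits P (\<Inter>A)"
  using assms by (induction A rule: finite_induct) (auto intro: splits_UNIV splits_Int)

lemma splits_const_coords:
  assumes "E \<subseteq> const_coords P"
  shows "splits P E"
  unfolding splits_def
proof (intro ballI)
  fix x y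
  assume "x \<in> P" "y \<in> P"
  then have "coord_proj E x + coord_proj (- E) y = y"
    using assms by (force simp: vec_eq_iff coord_proj_def const_coords_def)
  then show "coord_proj E x + coord_proj (- E) y \<in> P"
    using \<open>y \<in> P\<close> by simp
qed

section \<open>Minkowski summands of a 0/1-polytope\<close>

text \<open>
  Suppose that a functional \<open>w\<close> is smaller at \<open>q \<in> Q\<close> than on all of \<open>A\<close>, and let it attain its
  minimum over \<open>R\<close> at \<open>r\<close>.  Then \<open>q + r = a + b\<close> with \<open>a \<in> A\<close> and \<open>b \<in> B \<subseteq> R\<close> is impossible, since
  \<open>w \<bullet> q < w \<bullet> a\<close> and \<open>w \<bullet> r \<le> w \<bullet> b\<close>.
\<close>

lemma Minkowski_sum_cancel:
  fixes A B Q R :: "'a::euclidean_space set"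
  assumes A: "convex A" "closed A" and R: "compact R" "R \<noteq> {}" and "B \<subseteq> R"
    and sum: "Q + R \<subseteq> A + B"
  shows "Q \<subseteq> A"
proof
  fix q
  assume "q \<in> Q"
  show "q \<in> A"
  proof (rule ccontr)
    assume "q \<notin> A"
    then obtain w c where w: "w \<bullet> q < c" "\<And>x. x \<in> A \<Longrightarrow> c < w \<bullet> x"
      using separating_hyperplane_closed_point[OF A] by blast
    have "continuous_on R ((\<bullet>) w)"
      by (intro continuous_intros)
    then obtain r where r: "r \<in> R" "\<And>y. y \<in> R \<Longrightarrow> w \<bullet> r \<le> w \<bullet> y"
      using continuous_attains_inf[OF R] by blast
    obtain a b where ab: "a \<in> A" "b \<in> B" "q + r = a + b"
      using sum set_plus_intro[OF \<open>q \<in> Q\<close> r(1)] by (blast elim: set_plus_elim)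
    have "w \<bullet> q + w \<bullet> r = w \<bullet> a + w \<bullet> b"
      using arg_cong[OF ab(3), of "(\<bullet>) w"] by (simp add: inner_add_right)
    moreover have "w \<bullet> r \<le> w \<bullet> b"
      using r(2) ab(2) \<open>B \<subseteq> R\<close> by blast
    ultimately show False
      using w(1) w(2)[OF ab(1)] by linarith
  qed
qed

lemma polytope_in_compact_convex:
  assumes "polytope_in J P"
  shows "compact P" "convex P" "closed P" "P \<noteq> {}"
  using assms by (auto simp: polytope_in_def polytope_imp_compact polytope_imp_convex polytope_imp_closed)

lemma polytope_in_vertex_hull:
  assumes "polytope_in J P"
  shows "P = convex hull {v. v extreme_point_of P}"
  using Krein_Milman_Minkowski polytope_in_compact_convex[OF assms] by blast

lemma convex_containing_vertices:
  assumes "polytope_in J P" "convex C" "\<And>v. v extreme_point_of P \<Longrightarrow> v \<in> C"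
  shows "P \<subseteq> C"
proof -
  have "convex hull {v. v extreme_point_of P} \<subseteq> C"
    using assms(2,3) by (intro hull_minimal) auto
  then show ?thesis
    using polytope_in_vertex_hull[OF assms(1)] by simp
qed

lemma notin_imp_const_coord:
  assumes "polytope_in J P" "i \<notin> J"
  shows "i \<in> const_coords P"
  using assms unfolding polytope_in_def coord_space_def const_coords_def by blast

lemma zero_one_polytope_bounds:
  assumes "zero_one_polytope J P" "i \<in> J" "x \<in> P"
  shows "0 \<le> x $ i" "x $ i \<le> 1"
proof -
  have P: "polytope_in J P" and v: "\<And>v. v extreme_point_of P \<Longrightarrow> v $ i \<in> {0, 1}"
    using assms by (auto simp: zero_one_polytope_def)
  have "convex {x :: real ^ 'a. 0 \<le> x $ i \<and> x $ i \<le> 1}"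
    by (auto simp: convex_def intro!: add_nonneg_nonneg mult_nonneg_nonneg convex_bound_le)
  then have "P \<subseteq> {x. 0 \<le> x $ i \<and> x $ i \<le> 1}"
    by (rule convex_containing_vertices[OF P]) (use v in force)
  then show "0 \<le> x $ i" "x $ i \<le> 1"
    using assms(3) by auto
qed

text \<open>
  If no vertex has the entry \<open>c\<close>, all of them, and hence all points of \<open>P\<close>, have the entry \<open>1 - c\<close>.
\<close>

lemma zero_one_polytope_attains:
  fixes P :: "(real ^ 'n::finite) set"
  assumes "zero_one_polytope J P" "i \<notin> const_coords P" "c \<in> {0, 1}"
  obtains v where "v extreme_point_of P" "v $ i = c"
proof -
  have P: "polytope_in J P"
    using assms(1) by (simp add: zero_one_polytope_def)
  then have "i \<in> J"
    using assms(2) notin_imp_const_coord by blast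
  then have v: "\<And>v. v extreme_point_of P \<Longrightarrow> v $ i \<in> {0, 1}"
    using assms(1) by (auto simp: zero_one_polytope_def)
  have "\<exists>v. v extreme_point_of P \<and> v $ i = c"
  proof (rule ccontr)
    assume no: "\<not> ?thesis"
    have "convex {x :: real ^ 'n. x $ i = 1 - c}"
      by (simp add: convex_def flip: distrib_right)
    then have "P \<subseteq> {x. x $ i = 1 - c}"
    proof (rule convex_containing_vertices[OF P])
      fix v
      assume "v extreme_point_of P"
      then have "v $ i \<in> {0, 1}" "v $ i \<noteq> c"
        using v no by blast+
      then show "v \<in> {x. x $ i = 1 - c}"
        using assms(3) by auto
    qed
    then show False
      using assms(2) unfolding const_coords_def by blast
  qed
  then show ?thesis
    using that by blast
qed

text \<open>
  If \<open>v = q + r\<close> is a vertex with \<open>v $ i = 0\<close>, then \<open>q\<close> minimizes coordinate \<open>i\<close> over \<open>Q\<close>, since a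
  smaller entry would give a point of \<open>P\<close> with a negative entry; likewise \<open>v $ i = 1\<close> makes it
  maximal.  As these are the only two values, the entry of \<open>q\<close> is an affine function of the entry
  of \<open>v\<close>, with the width of \<open>Q\<close> as slope.
\<close>

lemma summand_coordinate_affine:
  fixes P Q R :: "(real ^ 'n::finite) set"
  assumes P: "zero_one_polytope J P" and sum: "P = Q + R"
  shows "\<exists>a l. 0 \<le> l \<and> l \<le> 1 \<and>
    (\<forall>q\<in>Q. \<forall>r\<in>R. (q + r) extreme_point_of P \<longrightarrow> q $ i = a + l * (q + r) $ i)"
proof -
  have sum_mem: "q + r \<in> P" if "q \<in> Q" "r \<in> R" for q r
    unfolding sum using that by (rule set_plus_intro)
  show ?thesis
  proof (cases "i \<in> const_coords P")
    case True
    then obtain c where c: "\<And>x. x \<in> P \<Longrightarrow> x $ i = c"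
      by (auto simp: const_coords_def)
    show ?thesis
    proof (cases "Q = {} \<or> R = {}")
      case True
      then show ?thesis
        by force
    next
      case False
      then obtain q0 r0 where "q0 \<in> Q" "r0 \<in> R"
        by blast
      have "q $ i + r0 $ i = q0 $ i + r0 $ i" if "q \<in> Q" for q
        using c[OF sum_mem[OF that \<open>r0 \<in> R\<close>]] c[OF sum_mem[OF \<open>q0 \<in> Q\<close> \<open>r0 \<in> R\<close>]] by simp
      then show ?thesis
        by - (rule exI[of _ "q0 $ i"], rule exI[of _ 0], auto)
    qed
  next
    case False
    have PJ: "polytope_in J P"
      using P by (simp add: zero_one_polytope_def)
    then have "i \<in> J"
      using False notin_imp_const_coord by blast
    have bounds: "0 \<le> q $ i + r $ i" "q $ i + r $ i \<le> 1" if "q \<in> Q" "r \<in> R" for q r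
      using zero_one_polytope_bounds[OF P \<open>i \<in> J\<close> sum_mem[OF that]] by simp_all
    have "\<exists>q\<in>Q. \<exists>r\<in>R. q $ i + r $ i = c" if c: "c \<in> {0, 1}" for c
    proof -
      obtain v where "v extreme_point_of P" "v $ i = c"
        using zero_one_polytope_attains[OF P False c] .
      moreover from this have "v \<in> Q + R"
        using sum by (simp add: extreme_point_of_def)
      ultimately show ?thesis
        by (metis set_plus_elim vector_add_component)
    qed
    from this[of 0] this[of 1] obtain q0 r0 q1 r1
      where 0: "q0 \<in> Q" "r0 \<in> R" "q0 $ i + r0 $ i = 0" and 1: "q1 \<in> Q" "r1 \<in> R" "q1 $ i + r1 $ i = 1"
      by auto
    show ?thesis
    proof (rule exI[of _ "q0 $ i"], rule exI[of _ "q1 $ i - q0 $ i"], intro conjI ballI impI)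
      show "0 \<le> q1 $ i - q0 $ i" "q1 $ i - q0 $ i \<le> 1"
        using bounds[OF 0(1) 1(2)] bounds[OF 1(1) 0(2)] 0(3) 1(3) by linarith+
    next
      fix q r
      assume qr: "q \<in> Q" "r \<in> R" and ext: "(q + r) extreme_point_of P"
      have "q0 $ i \<le> q $ i" "q $ i \<le> q1 $ i" "r0 $ i \<le> r $ i" "r $ i \<le> r1 $ i"
        using bounds[OF qr(1) 0(2)] bounds[OF qr(1) 1(2)] bounds[OF 0(1) qr(2)] bounds[OF 1(1) qr(2)]
          0(3) 1(3) by linarith+
      moreover have "q $ i + r $ i = 0 \<or> q $ i + r $ i = 1"
        using P ext \<open>i \<in> J\<close> unfolding zero_one_polytope_def
        by (metis empty_iff insert_iff vector_add_component)
      ultimately have "q $ i = q0 $ i + (q1 $ i - q0 $ i) * (q $ i + r $ i)"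
        using 0(3) 1(3) by (elim disjE) simp_all
      then show "q $ i = q0 $ i + (q1 $ i - q0 $ i) * (q + r) $ i"
        by simp
    qed
qed
qed

text \<open>
  The affine maps \<open>x \<mapsto> a + l * x\<close> and \<open>x \<mapsto> (1 - l) * x - a\<close> add up to the identity and carry the
  vertices of \<open>P\<close>, hence \<open>P\<close> itself, into \<open>Q\<close> and \<open>R\<close>; cancellation shows that nothing is missed.
\<close>

lemma summands_diagonal_images:
  fixes P Q R :: "(real ^ 'n::finite) set"
  assumes P: "zero_one_polytope J P" and QR: "polytope_in J Q" "polytope_in J R"
    and sum: "P = Q + R"
  obtains a l where "\<forall>i. 0 \<le> l $ i \<and> l $ i \<le> 1"
    "Q = (\<lambda>x. a + l * x) ` P" "R = (\<lambda>x. (1 - l) * x - a) ` P"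
proof -
  have PJ: "polytope_in J P"
    using P by (simp add: zero_one_polytope_def)
  obtain a l where al: "\<And>i. 0 \<le> l i \<and> l i \<le> 1"
      "\<And>i q r. q \<in> Q \<Longrightarrow> r \<in> R \<Longrightarrow> (q + r) extreme_point_of P \<Longrightarrow> q $ i = a i + l i * (q + r) $ i"
    using summand_coordinate_affine[OF P sum] by metis
  define b m where "b = (\<chi> i. a i)" and "m = (\<chi> i. l i)"
  define f g where "f = (\<lambda>x. b + m * x)" and "g = (\<lambda>x. (1 - m) * x - b)"
  have fg: "f x + g x = x" for x
    by (simp add: f_def g_def algebra_simps)
  have f_mix: "f (u *\<^sub>R x + v *\<^sub>R y) = u *\<^sub>R f x + v *\<^sub>R f y"
    and g_mix: "g (u *\<^sub>R x + v *\<^sub>R y) = u *\<^sub>R g x + v *\<^sub>R g y" if "u + v = 1" for u v x y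
  proof -
    have v: "v = 1 - u"
      using that by simp
    show "f (u *\<^sub>R x + v *\<^sub>R y) = u *\<^sub>R f x + v *\<^sub>R f y"
      and "g (u *\<^sub>R x + v *\<^sub>R y) = u *\<^sub>R g x + v *\<^sub>R g y"
      unfolding v f_def g_def vec_eq_iff by (simp_all add: algebra_simps)
  qed
  have q_eq: "q = f (q + r)" and r_eq: "r = g (q + r)"
    if "q \<in> Q" "r \<in> R" "(q + r) extreme_point_of P" for q r
  proof -
    show "q = f (q + r)"
      using al(2)[OF that] by (simp add: f_def b_def m_def vec_eq_iff)
    then show "r = g (q + r)"
      using fg[of "q + r"] by (metis add_left_cancel)
  qed
  have cont_mult: "continuous_on P (\<lambda>x. z * x)" for z :: "real ^ 'n"
    by (intro linear_continuous_on linear_conv_bounded_linear[THEN iffD1] linearI)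
      (simp_all add: algebra_simps)
  have "f v \<in> Q \<and> g v \<in> R" if "v extreme_point_of P" for v
  proof -
    have "v \<in> Q + R"
      using that sum by (simp add: extreme_point_of_def)
    then obtain q r where "v = q + r" "q \<in> Q" "r \<in> R"
      by (auto elim: set_plus_elim)
    then show ?thesis
      using q_eq r_eq that by metis
  qed
  moreover have "convex {x. f x \<in> Q \<and> g x \<in> R}"
    using polytope_in_compact_convex(2)[OF QR(1)] polytope_in_compact_convex(2)[OF QR(2)]
    by (simp add: convex_def f_mix g_mix)
  ultimately have "P \<subseteq> {x. f x \<in> Q \<and> g x \<in> R}"
    using convex_containing_vertices[OF PJ] by blast
  then have sub: "f ` P \<subseteq> Q" "g ` P \<subseteq> R"
    by auto
  have cont: "continuous_on P f" "continuous_on P g"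
    unfolding f_def g_def by (intro continuous_intros cont_mult)+
  have "convex (h ` P)" if "\<And>u v x y. u + v = 1 \<Longrightarrow> h (u *\<^sub>R x + v *\<^sub>R y) = u *\<^sub>R h x + v *\<^sub>R h y"
    for h :: "real ^ 'n \<Rightarrow> real ^ 'n"
    unfolding convex_def
  proof (intro ballI allI impI)
    fix x y and u v :: real
    assume xy: "x \<in> h ` P" "y \<in> h ` P" and uv: "0 \<le> u" "0 \<le> v" "u + v = 1"
    then obtain p q where "x = h p" "y = h q" "p \<in> P" "q \<in> P"
      by blast
    moreover from this have "u *\<^sub>R p + v *\<^sub>R q \<in> P"
      using polytope_in_compact_convex(2)[OF PJ] uv by (simp add: convex_def)
    ultimately show "u *\<^sub>R x + v *\<^sub>R y \<in> h ` P"
      using that[OF uv(3)] by (metis imageI)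
  qed
  then have "convex (f ` P)" "convex (g ` P)"
    using f_mix g_mix by blast+
  moreover have "closed (f ` P)" "closed (g ` P)"
    using compact_continuous_image[OF cont(1)] compact_continuous_image[OF cont(2)]
      polytope_in_compact_convex(1)[OF PJ] by (auto intro: compact_imp_closed)
  moreover have "Q + R \<subseteq> f ` P + g ` P"
  proof
    fix x
    assume "x \<in> Q + R"
    then have "f x + g x \<in> f ` P + g ` P"
      using sum by (intro set_plus_intro) auto
    then show "x \<in> f ` P + g ` P"
      by (simp add: fg)
  qed
  ultimately have "Q \<subseteq> f ` P" "R \<subseteq> g ` P"
    using Minkowski_sum_cancel[of "f ` P" R "g ` P" Q] Minkowski_sum_cancel[of "g ` P" Q "f ` P" R]
      sub polytope_in_compact_convex[OF QR(1)] polytope_in_compact_convex[OF QR(2)]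
    by (auto simp: add.commute)
  then have "Q = f ` P" "R = g ` P"
    using sub by auto
  then show ?thesis
    using that[of m b] al(1) by (simp add: f_def g_def m_def)
qed

text \<open>
  On the constant coordinates every slope has the effect of a translation.
\<close>

lemma homothetic_diagonal_image:
  fixes P :: "(real ^ 'n::finite) set"
  assumes "P \<noteq> {}" "c > 0" "\<And>i. i \<notin> const_coords P \<Longrightarrow> l $ i = c"
  shows "homothetic ((\<lambda>x. a + l * x) ` P) P"
proof -
  obtain p where "p \<in> P"
    using assms(1) by blast
  have "a + l * x = (a + l * p - c *\<^sub>R p) + c *\<^sub>R x" if "x \<in> P" for x
    unfolding vec_eq_iff
  proof
    fix i
    have "x $ i = p $ i" if "i \<in> const_coords P"
      using that \<open>x \<in> P\<close> \<open>p \<in> P\<close> unfolding const_coords_def by fastforce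
    then have "l $ i = c \<or> x $ i = p $ i"
      using assms(3) by blast
    then show "(a + l * x) $ i = ((a + l * p - c *\<^sub>R p) + c *\<^sub>R x) $ i"
      by auto
  qed
  then have "(\<lambda>x. a + l * x) ` P = (\<lambda>x. (a + l * p - c *\<^sub>R p) + c *\<^sub>R x) ` P"
    by (rule image_cong[OF refl])
  then show ?thesis
    unfolding homothetic_def using assms(2) by blast
qed

text \<open>
  If the slopes agreed on all nonconstant coordinates, one of the summands would be homothetic
  to \<open>P\<close>.  With two different slopes, \<open>l * x + (1 - l) * y\<close> is the sum of the image of \<open>x\<close> in \<open>Q\<close>
  and the image of \<open>y\<close> in \<open>R\<close>, so \<open>l\<close> is a weight vector that separates two coordinates.
\<close>

theorem decomposable_imp_splits:
  fixes P :: "(real ^ 'n::finite) set"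
  assumes P: "zero_one_polytope J P" and dec: "decomposable J P"
  obtains E i j where "splits P E" "i \<in> E" "j \<notin> E" "i \<notin> const_coords P" "j \<notin> const_coords P"
proof -
  have PJ: "polytope_in J P"
    using P by (simp add: zero_one_polytope_def)
  then have "P \<noteq> {}" "closed P"
    using polytope_in_compact_convex by blast+
  obtain Q R where QR: "polytope_in J Q" "polytope_in J R" and sum: "P = Q + R"
      and hom: "\<not> homothetic Q P" "\<not> homothetic R P"
    using dec unfolding decomposable_def by blast
  obtain a l where l01: "\<forall>i. 0 \<le> l $ i \<and> l $ i \<le> 1"
      and Q: "Q = (\<lambda>x. a + l * x) ` P" and R: "R = (\<lambda>x. (1 - l) * x - a) ` P"
    using summands_diagonal_images[OF P QR sum] .
  have "mixes P l"
    unfolding mixes_def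
  proof (intro ballI)
    fix x y
    assume "x \<in> P" "y \<in> P"
    then have "(a + l * x) + ((1 - l) * y - a) \<in> Q + R"
      unfolding Q R by blast
    then show "l * x + (1 - l) * y \<in> P"
      by (simp add: sum)
  qed
  have "\<exists>i j. i \<notin> const_coords P \<and> j \<notin> const_coords P \<and> l $ j < l $ i"
  proof (rule ccontr)
    assume no: "\<not> ?thesis"
    \<comment> \<open>If every coordinate is constant, the slope 1 serves as well as any other.\<close>
    obtain c where c: "0 \<le> c" "c \<le> 1" "\<And>i. i \<notin> const_coords P \<Longrightarrow> l $ i = c"
    proof (cases "const_coords P = UNIV")
      case True
      then show ?thesis
        using that[of 1] by auto
    next
      case False
      then obtain i0 where "i0 \<notin> const_coords P"
        by blast
      then have "l $ i = l $ i0" if "i \<notin> const_coords P" for i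
        using no that by (meson linorder_neqE)
      then show ?thesis
        using that[of "l $ i0"] l01 by blast
    qed
    show False
    proof (cases "c = 0")
      case True
      have "homothetic ((\<lambda>x. - a + (1 - l) * x) ` P) P"
        by (rule homothetic_diagonal_image[where c = 1]) (use \<open>P \<noteq> {}\<close> c(3) True in auto)
      then show False
        using hom(2) by (simp add: R)
    next
      case False
      then have "homothetic Q P"
        unfolding Q using c \<open>P \<noteq> {}\<close> by (intro homothetic_diagonal_image[where c = c]) auto
      then show False
        using hom(1) by blast
    qed
  qed
  then obtain i j where "i \<notin> const_coords P" "j \<notin> const_coords P" "l $ j < l $ i"
    by blast
  moreover from this obtain E where "splits P E" "i \<in> E" "j \<notin> E"
    using mixes_imp_splits[OF \<open>closed P\<close> \<open>mixes P l\<close> l01] by blast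
  ultimately show ?thesis
    using that by blast
qed

lemma linear_coord_proj: "linear (coord_proj E)"
  by (rule linearI) (simp_all add: vec_eq_iff coord_proj_def)

lemma coord_proj_add_Compl: "coord_proj E x + coord_proj (- E) x = x"
  by (simp add: vec_eq_iff coord_proj_def)

lemma polytope_in_coord_proj_image:
  assumes "polytope_in J P"
  shows "polytope_in J (coord_proj E ` P)"
  using assms polytope_linear_image[OF linear_coord_proj]
  by (auto simp: polytope_in_def coord_space_def coord_proj_def)

text \<open>
  The two summands are the projections of \<open>P\<close>; each has become constant in a coordinate in which
  \<open>P\<close> is not.
\<close>

theorem splits_imp_decomposable:
  fixes P :: "(real ^ 'n::finite) set"
  assumes P: "polytope_in J P" and "splits P E" and i: "i \<in> E" "i \<notin> const_coords P"
    and j: "j \<notin> E" "j \<notin> const_coords P"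
  shows "decomposable J P"
  unfolding decomposable_def
proof (intro exI conjI)
  show "polytope_in J (coord_proj E ` P)" "polytope_in J (coord_proj (- E) ` P)"
    using P by (rule polytope_in_coord_proj_image)+
  show "P = coord_proj E ` P + coord_proj (- E) ` P"
  proof
    show "P \<subseteq> coord_proj E ` P + coord_proj (- E) ` P"
      using coord_proj_add_Compl by (metis imageI set_plus_intro subsetI)
    show "coord_proj E ` P + coord_proj (- E) ` P \<subseteq> P"
      using \<open>splits P E\<close> by (auto simp: splits_def elim!: set_plus_elim)
  qed
  have not_homothetic: "\<not> homothetic (coord_proj F ` P) P" if "k \<notin> F" "k \<notin> const_coords P" for F k
  proof
    assume "homothetic (coord_proj F ` P) P"
    then obtain c t where ct: "c > 0" "coord_proj F ` P = (\<lambda>x. t + c *\<^sub>R x) ` P"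
      by (auto simp: homothetic_def)
    have "x $ k = - t $ k / c" if "x \<in> P" for x
    proof -
      have "t + c *\<^sub>R x \<in> coord_proj F ` P"
        using that ct(2) by blast
      then obtain y where "t + c *\<^sub>R x = coord_proj F y"
        by blast
      from arg_cong[OF this, of "\<lambda>z. z $ k"] have "t $ k + c * x $ k = 0"
        using \<open>k \<notin> F\<close> by (simp add: coord_proj_def)
      then show ?thesis
        using ct(1) by (simp add: field_simps)
    qed
    then show False
      using \<open>k \<notin> const_coords P\<close> by (auto simp: const_coords_def)
  qed
  show "\<not> homothetic (coord_proj E ` P) P"
    using j by (rule not_homothetic)
  show "\<not> homothetic (coord_proj (- E) ` P) P"
    using i by (intro not_homothetic[of i]) auto
qed

section \<open>The finest product decomposition\<close>

text \<open>
  The splitting sets form a Boolean algebra, and every set of constant coordinates belongs to it.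
  Modulo the constant coordinates, its atom containing a nonconstant coordinate \<open>i\<close> is the following
  set.
\<close>

definition block :: "(real ^ 'n::finite) set \<Rightarrow> 'n \<Rightarrow> 'n set" where
  "block P i = \<Inter>{E. splits P E \<and> i \<in> E} - const_coords P"

lemma splits_block: "splits P (block P i)"
proof -
  have "splits P (\<Inter>{E. splits P E \<and> i \<in> E})"
    by (rule splits_Inter) auto
  moreover have "splits P (- const_coords P)"
    by (intro splits_Compl splits_const_coords order_refl)
  ultimately show ?thesis
    unfolding block_def Diff_eq by (rule splits_Int)
qed

lemma mem_block_self: "i \<notin> const_coords P \<Longrightarrow> i \<in> block P i"
  by (simp add: block_def)

lemma block_nonconst: "j \<in> block P i \<Longrightarrow> j \<notin> const_coords P"
  by (simp add: block_def)

lemma block_least: "splits P E \<Longrightarrow> i \<in> E \<Longrightarrow> block P i \<subseteq> E"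
  by (auto simp: block_def)

lemma block_eq:
  assumes "j \<in> block P i"
  shows "block P j = block P i"
proof
  show sub: "block P j \<subseteq> block P i"
    using splits_block assms by (rule block_least)
  have "i \<in> block P j \<or> i \<in> const_coords P"
  proof (rule ccontr)
    assume i: "\<not> ?thesis"
    then have "block P i \<subseteq> block P i \<inter> - block P j"
      by (intro block_least splits_Int splits_Compl splits_block) (auto intro: mem_block_self)
    then show False
      using assms mem_block_self[OF block_nonconst[OF assms]] by blast
  qed
  then show "block P i \<subseteq> block P j"
  proof
    assume "i \<in> block P j"
    then show ?thesis
      by (rule block_least[OF splits_block])
  next
    \<comment> \<open>The constant coordinates form a splitting set, so the block of one of them is empty.\<close>
    assume i: "i \<in> const_coords P"
    then have "block P i \<subseteq> const_coords P"
      by (intro block_least splits_const_coords) auto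
    then show ?thesis
      using block_nonconst by blast
  qed
qed

lemma zero_one_polytope_coord_proj_image:
  fixes P :: "(real ^ 'n::finite) set"
  assumes P: "zero_one_polytope UNIV P"
  shows "zero_one_polytope J (coord_proj J ` P)"
  unfolding zero_one_polytope_def
proof (intro conjI allI impI ballI)
  have PU: "polytope_in UNIV P"
    using P by (simp add: zero_one_polytope_def)
  have "coord_proj J ` P \<subseteq> coord_space J"
    by (auto simp: coord_space_def coord_proj_def)
  then show "polytope_in J (coord_proj J ` P)"
    using polytope_in_coord_proj_image[OF PU, of J] by (simp add: polytope_in_def)
  fix v i
  assume v: "v extreme_point_of (coord_proj J ` P)" and "i \<in> J"
  have "coord_proj J ` P = convex hull (coord_proj J ` {v. v extreme_point_of P})"
    by (subst polytope_in_vertex_hull[OF PU]) (rule convex_hull_linear_image[OF linear_coord_proj])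
  then obtain u where "u extreme_point_of P" "v = coord_proj J u"
    using v extreme_point_of_convex_hull[of v "coord_proj J ` {v. v extreme_point_of P}"] by auto
  then show "v $ i \<in> {0, 1}"
    using P \<open>i \<in> J\<close> by (simp add: zero_one_polytope_def coord_proj_def)
qed

lemma const_coords_coord_proj_image: "const_coords (coord_proj J ` P) = const_coords P \<union> - J"
  by (auto simp: const_coords_def coord_proj_def)

lemma splits_coord_proj_image:
  assumes "splits P E"
  shows "splits (coord_proj J ` P) E"
proof -
  have "coord_proj E (coord_proj J x) + coord_proj (- E) (coord_proj J y) =
      coord_proj J (coord_proj E x + coord_proj (- E) y)" for x y
    by (simp add: vec_eq_iff coord_proj_def)
  then show ?thesis
    using assms by (simp add: splits_def)
qed

text \<open>
  To mix \<open>x\<close> and \<open>y\<close> along \<open>E \<inter> J\<close>, mix their projections within the factor and leave \<open>y\<close>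
  untouched outside \<open>J\<close>.
\<close>

lemma splits_factor:
  assumes J: "splits P J" and E: "splits (coord_proj J ` P) E"
  shows "splits P (E \<inter> J)"
  unfolding splits_def
proof (intro ballI)
  fix x y
  assume "x \<in> P" "y \<in> P"
  then obtain w where "w \<in> P"
      and w: "coord_proj E (coord_proj J x) + coord_proj (- E) (coord_proj J y) = coord_proj J w"
    using E unfolding splits_def by blast
  have "coord_proj (E \<inter> J) x + coord_proj (- (E \<inter> J)) y = coord_proj J w + coord_proj (- J) y"
    unfolding w[symmetric] by (auto simp: vec_eq_iff coord_proj_def)
  then show "coord_proj (E \<inter> J) x + coord_proj (- (E \<inter> J)) y \<in> P"
    using J \<open>w \<in> P\<close> \<open>y \<in> P\<close> by (simp add: splits_def)
qed

lemma indecomposable_block_factor: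
  assumes P: "zero_one_polytope UNIV P"
  shows "indecomposable (block P i) (coord_proj (block P i) ` P)"
proof
  assume "decomposable (block P i) (coord_proj (block P i) ` P)"
  then obtain E j l where E: "splits (coord_proj (block P i) ` P) E" and "j \<in> E" "l \<notin> E"
      and nonconst: "j \<notin> const_coords (coord_proj (block P i) ` P)" "l \<notin> const_coords (coord_proj (block P i) ` P)"
    using decomposable_imp_splits[OF zero_one_polytope_coord_proj_image[OF P]] by metis
  then have jl: "j \<in> block P i" "l \<in> block P i"
    by (simp_all add: const_coords_coord_proj_image)
  have "block P j \<subseteq> E \<inter> block P i"
    using splits_factor[OF splits_block E] \<open>j \<in> E\<close> jl(1) by (intro block_least) auto
  then show False
    using block_eq[OF jl(1)] jl(2) \<open>l \<notin> E\<close> by blast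
qed

text \<open>
  Points that match \<open>x\<close> on single members of \<open>A\<close> are merged one at a time; where members overlap
  there is no conflict, because all these points agree with \<open>x\<close>.
\<close>

lemma splits_glue:
  assumes "finite A" "\<And>E. E \<in> A \<Longrightarrow> splits P E" "P \<noteq> {}"
    "\<And>E. E \<in> A \<Longrightarrow> coord_proj E x \<in> coord_proj E ` P"
  shows "\<exists>y\<in>P. \<forall>i\<in>\<Union>A. y $ i = x $ i"
  using assms(1,2,4)
proof (induction A rule: finite_induct)
  case empty
  then show ?case
    using \<open>P \<noteq> {}\<close> by auto
next
  case (insert E A)
  then obtain y where y: "y \<in> P" "\<forall>i\<in>\<Union>A. y $ i = x $ i"
    by blast
  obtain z where z: "z \<in> P" "coord_proj E x = coord_proj E z"
    using insert.prems(2)[of E] by blast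
  have xz: "x $ i = z $ i" if "i \<in> E" for i
    using arg_cong[OF z(2), of "\<lambda>v. v $ i"] that by (simp add: coord_proj_def)
  have "coord_proj E z + coord_proj (- E) y \<in> P"
    using insert.prems(1)[of E] y(1) z(1) by (simp add: splits_def)
  moreover have "\<forall>i\<in>\<Union>(insert E A). (coord_proj E z + coord_proj (- E) y) $ i = x $ i"
    using xz y(2) by (auto simp: coord_proj_def)
  ultimately show ?case
    by blast
qed

lemma splits_imp_cart_product:
  fixes P :: "(real ^ 'n::finite) set"
  assumes "P \<noteq> {}" and J: "\<And>i. i \<in> {1..k} \<Longrightarrow> splits P (J i)" "(\<Union>i\<in>{1..k}. J i) = UNIV - J0"
    and p0: "\<And>x. x \<in> P \<Longrightarrow> coord_proj J0 x = p0"
  shows "P = cart_product J0 p0 k J (\<lambda>i. coord_proj (J i) ` P)"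
proof
  show "P \<subseteq> cart_product J0 p0 k J (\<lambda>i. coord_proj (J i) ` P)"
    using p0 by (auto simp: cart_product_def)
  show "cart_product J0 p0 k J (\<lambda>i. coord_proj (J i) ` P) \<subseteq> P"
  proof
    fix x
    assume "x \<in> cart_product J0 p0 k J (\<lambda>i. coord_proj (J i) ` P)"
    then have x0: "coord_proj J0 x = p0"
        and xJ: "\<And>i. i \<in> {1..k} \<Longrightarrow> coord_proj (J i) x \<in> coord_proj (J i) ` P"
      by (simp_all add: cart_product_def)
    have "\<exists>y\<in>P. \<forall>i\<in>\<Union>(J ` {1..k}). y $ i = x $ i"
      by (rule splits_glue) (use J(1) xJ \<open>P \<noteq> {}\<close> in auto)
    then obtain y where y: "y \<in> P" "\<forall>i\<in>UNIV - J0. y $ i = x $ i"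
      using J(2) by auto
    have "coord_proj J0 y = coord_proj J0 x"
      using p0[OF y(1)] x0 by simp
    then have "y $ i = x $ i" if "i \<in> J0" for i
      using that by (simp add: coord_proj_def vec_eq_iff) metis
    then have "y = x"
      using y(2) by (auto simp: vec_eq_iff)
    then show "x \<in> P"
      using y(1) by simp
  qed
qed

text \<open>Conversely, the factors of a product are determined by the sets of coordinates.\<close>

lemma zero_one_product_factor:
  fixes P :: "(real ^ 'n::finite) set"
  assumes prod: "zero_one_product P J0 p0 k J Q" and "P \<noteq> {}" and i: "i \<in> {1..k}"
  shows "splits P (J i)" "Q i = coord_proj (J i) ` P"
proof -
  have P: "P = cart_product J0 p0 k J Q" and part: "nonempty_partition (UNIV - J0) k J"
      and "zero_one_polytope (J i) (Q i)"
    using prod i by (simp_all add: zero_one_product_def)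
  then have Qi: "coord_proj (J i) q = q" if "q \<in> Q i" for q
    using that by (auto simp: zero_one_polytope_def polytope_in_def coord_space_def coord_proj_def vec_eq_iff)
  have disj: "J i \<inter> J0 = {}" "\<And>l. l \<in> {1..k} \<Longrightarrow> l \<noteq> i \<Longrightarrow> J i \<inter> J l = {}"
    using part i unfolding nonempty_partition_def disjoint_family_on_def by blast+
  \<comment> \<open>Replacing the component in \<open>J i\<close> of a point of \<open>P\<close> by any point of \<open>Q i\<close> stays in \<open>P\<close>.\<close>
  have replace: "coord_proj (J i) z + coord_proj (- J i) y \<in> P"
    if "coord_proj (J i) z \<in> Q i" "y \<in> P" for y z
  proof -
    let ?w = "coord_proj (J i) z + coord_proj (- J i) y"
    have same: "coord_proj F ?w = coord_proj F y" if "J i \<inter> F = {}" for F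
      using that by (auto simp: vec_eq_iff coord_proj_def)
    have "coord_proj (J i) ?w = coord_proj (J i) z"
      by (auto simp: vec_eq_iff coord_proj_def)
    then have "coord_proj (J l) ?w \<in> Q l" if "l \<in> {1..k}" for l
      using same[OF disj(2)[OF that]] \<open>coord_proj (J i) z \<in> Q i\<close> \<open>y \<in> P\<close> that
      by (cases "l = i") (auto simp: P cart_product_def)
    moreover have "coord_proj J0 ?w = p0"
      using same[OF disj(1)] \<open>y \<in> P\<close> by (simp add: P cart_product_def)
    ultimately show ?thesis
      by (simp add: P cart_product_def)
  qed
  have sub: "coord_proj (J i) x \<in> Q i" if "x \<in> P" for x
    using that i by (simp add: P cart_product_def)
  then show "splits P (J i)"
    using replace by (simp add: splits_def)
  show "Q i = coord_proj (J i) ` P"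
  proof
    show "coord_proj (J i) ` P \<subseteq> Q i"
      using sub by blast
    show "Q i \<subseteq> coord_proj (J i) ` P"
    proof
      fix q
      assume q: "q \<in> Q i"
      obtain y where "y \<in> P"
        using \<open>P \<noteq> {}\<close> by blast
      then have "coord_proj (J i) q + coord_proj (- J i) y \<in> P"
        using q Qi[OF q] by (intro replace) auto
      moreover have "q = coord_proj (J i) (coord_proj (J i) q + coord_proj (- J i) y)"
        by (subst Qi[OF q, symmetric]) (auto simp: vec_eq_iff coord_proj_def)
      ultimately show "q \<in> coord_proj (J i) ` P"
        by blast
    qed
  qed
qed

text \<open>
  A factor is a union of blocks; a block strictly inside it would split the factor and thus
  decompose it.
\<close>

lemma indecomposable_product_block:
  fixes P :: "(real ^ 'n::finite) set"
  assumes prod: "indecomposable_product P (const_coords P) p0 k J Q" and "P \<noteq> {}"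
    and i: "i \<in> {1..k}" and j: "j \<in> J i"
  shows "J i = block P j"
proof
  have zop: "zero_one_product P (const_coords P) p0 k J Q" and indec: "indecomposable (J i) (Q i)"
    using prod i by (simp_all add: indecomposable_product_def)
  have Ji: "splits P (J i)" and Qi: "Q i = coord_proj (J i) ` P"
    using zero_one_product_factor[OF zop \<open>P \<noteq> {}\<close> i] by blast+
  have nonconst: "J i \<inter> const_coords P = {}" and pol: "polytope_in (J i) (Q i)"
    using zop i unfolding zero_one_product_def nonempty_partition_def zero_one_polytope_def by blast+
  show "block P j \<subseteq> J i"
    using Ji j by (rule block_least)
  show "J i \<subseteq> block P j"
  proof (rule ccontr)
    assume "\<not> J i \<subseteq> block P j"
    then obtain l where l: "l \<in> J i" "l \<notin> block P j"
      by blast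
    have "splits (Q i) (block P j)"
      unfolding Qi by (intro splits_coord_proj_image splits_block)
    moreover have "j \<in> block P j"
      using j nonconst by (intro mem_block_self) blast
    moreover have "j \<notin> const_coords (Q i)" "l \<notin> const_coords (Q i)"
      using j l(1) nonconst unfolding Qi const_coords_coord_proj_image by blast+
    ultimately have "decomposable (J i) (Q i)"
      using splits_imp_decomposable[OF pol] l(2) by blast
    then show False
      using indec by contradiction
  qed
qed

lemma indecomposable_product_bij_blocks:
  fixes P :: "(real ^ 'n::finite) set"
  assumes prod: "indecomposable_product P (const_coords P) p0 k J Q" and "P \<noteq> {}"
  shows "bij_betw J {1..k} (block P ` (- const_coords P))"
proof -
  have ne: "\<And>i. i \<in> {1..k} \<Longrightarrow> J i \<noteq> {}" and disj: "disjoint_family_on J {1..k}"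
      and un: "(\<Union>i\<in>{1..k}. J i) = UNIV - const_coords P"
    using prod unfolding indecomposable_product_def zero_one_product_def nonempty_partition_def by blast+
  have "inj_on J {1..k}"
  proof (rule inj_onI)
    fix a b
    assume "a \<in> {1..k}" "b \<in> {1..k}" "J a = J b"
    then show "a = b"
      using ne[of a] disj unfolding disjoint_family_on_def by blast
  qed
  moreover have "J ` {1..k} = block P ` (- const_coords P)"
  proof (intro equalityI subsetI)
    fix F
    assume "F \<in> J ` {1..k}"
    then obtain i where i: "i \<in> {1..k}" "F = J i"
      by blast
    then obtain j where "j \<in> J i"
      using ne by blast
    then show "F \<in> block P ` (- const_coords P)"
      using indecomposable_product_block[OF prod \<open>P \<noteq> {}\<close> i(1)] i un by blast
  next
    fix F
    assume "F \<in> block P ` (- const_coords P)"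
    then obtain j where j: "j \<in> UNIV - const_coords P" "F = block P j"
      by blast
    then obtain i where "i \<in> {1..k}" "j \<in> J i"
      using un by blast
    then show "F \<in> J ` {1..k}"
      using indecomposable_product_block[OF prod \<open>P \<noteq> {}\<close>] j(2) by blast
  qed
  ultimately show ?thesis
    by (simp add: bij_betw_def)
qed

lemma indecomposable_product_exists:
  fixes P :: "(real ^ 'n::finite) set"
  assumes P: "zero_one_polytope UNIV P" and p0: "\<And>x. x \<in> P \<Longrightarrow> coord_proj (const_coords P) x = p0"
  shows "\<exists>k J Q. indecomposable_product P (const_coords P) p0 k J Q"
proof -
  have "P \<noteq> {}"
    using P by (simp add: zero_one_polytope_def polytope_in_def)
  let ?B = "block P ` (- const_coords P)"
  obtain J where J: "bij_betw J {1..card ?B} ?B"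
    using ex_bij_betw_nat_finite_1[of ?B] by auto
  define k where "k = card ?B"
  define Q where "Q = (\<lambda>i. coord_proj (J i) ` P)"
  have img: "J ` {1..k} = ?B" and inj: "inj_on J {1..k}"
    using J by (simp_all add: bij_betw_def k_def)
  have Jblock: "\<exists>j. j \<notin> const_coords P \<and> J i = block P j" if "i \<in> {1..k}" for i
    using that img by blast
  have "\<forall>i\<in>{1..k}. J i \<noteq> {}"
    using Jblock mem_block_self by blast
  moreover have "disjoint_family_on J {1..k}"
    unfolding disjoint_family_on_def
  proof (intro ballI impI equals0I)
    fix a b l
    assume ab: "a \<in> {1..k}" "b \<in> {1..k}" "a \<noteq> b" and l: "l \<in> J a \<inter> J b"
    have "J a = block P l" "J b = block P l"
      using Jblock[OF ab(1)] Jblock[OF ab(2)] l block_eq by blast+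
    then show False
      using inj_onD[OF inj _ ab(1,2)] ab(3) by simp
  qed
  moreover have union: "(\<Union>i\<in>{1..k}. J i) = UNIV - const_coords P"
  proof
    show "(\<Union>i\<in>{1..k}. J i) \<subseteq> UNIV - const_coords P"
      unfolding img using block_nonconst by fast
    show "UNIV - const_coords P \<subseteq> (\<Union>i\<in>{1..k}. J i)"
      unfolding img using mem_block_self by fast
  qed
  ultimately have "nonempty_partition (UNIV - const_coords P) k J"
    by (simp add: nonempty_partition_def)
  moreover have "zero_one_polytope (J i) (Q i)" for i
    unfolding Q_def using P by (rule zero_one_polytope_coord_proj_image)
  moreover have "proper (Q i)" if i: "i \<in> {1..k}" for i
  proof -
    obtain j where "j \<notin> const_coords P" "J i = block P j"
      using Jblock[OF i] by blast
    then have "j \<notin> const_coords (Q i)"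
      using mem_block_self by (simp add: Q_def const_coords_coord_proj_image)
    then show ?thesis
      by (auto simp: proper_def const_coords_def)
  qed
  moreover have "indecomposable (J i) (Q i)" if "i \<in> {1..k}" for i
    using Jblock[OF that] indecomposable_block_factor[OF P] by (auto simp: Q_def)
  moreover have "P = cart_product (const_coords P) p0 k J Q"
    unfolding Q_def
  proof (rule splits_imp_cart_product[OF \<open>P \<noteq> {}\<close> _ union p0])
    fix i
    assume "i \<in> {1..k}"
    then show "splits P (J i)"
      using Jblock splits_block[of P] by metis
  qed
  ultimately have "indecomposable_product P (const_coords P) p0 k J Q"
    by (simp add: indecomposable_product_def zero_one_product_def)
  then show ?thesis
    by blast
qed

lemma zero_one_product_imp_decomposable:
  fixes P :: "(real ^ 'n::finite) set"
  assumes P: "zero_one_polytope UNIV P" and prod: "zero_one_product P (const_coords P) p0 k J Q"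
    and "k \<ge> 2"
  shows "decomposable UNIV P"
proof -
  have pol: "polytope_in UNIV P" and "P \<noteq> {}"
    using P by (simp_all add: zero_one_polytope_def polytope_in_def)
  have part: "nonempty_partition (UNIV - const_coords P) k J"
    using prod by (simp add: zero_one_product_def)
  have k: "1 \<in> {1..k}" "2 \<in> {1..k}"
    using \<open>k \<ge> 2\<close> by auto
  have "J 1 \<noteq> {}" "J 2 \<noteq> {}"
    using part k by (simp_all add: nonempty_partition_def)
  then obtain i j where ij: "i \<in> J 1" "j \<in> J 2"
    by blast
  have "J 1 \<inter> const_coords P = {}" "J 2 \<inter> const_coords P = {}"
    using part k unfolding nonempty_partition_def by blast+
  then have nonconst: "i \<notin> const_coords P" "j \<notin> const_coords P"
    using ij by blast+
  have "J 1 \<inter> J 2 = {}"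
    using part k by (auto simp: nonempty_partition_def disjoint_family_on_def)
  then have "j \<notin> J 1"
    using ij(2) by blast
  then show ?thesis
    using splits_imp_decomposable[OF pol zero_one_product_factor(1)[OF prod \<open>P \<noteq> {}\<close> k(1)]] ij(1) nonconst
    by blast
qed

lemma decomposable_imp_two_factors:
  fixes P :: "(real ^ 'n::finite) set"
  assumes P: "zero_one_polytope UNIV P" and dec: "decomposable UNIV P"
    and prod: "indecomposable_product P (const_coords P) p0 k J Q"
  shows "k \<ge> 2"
proof (rule ccontr)
  assume "\<not> k \<ge> 2"
  have "P \<noteq> {}"
    using P by (simp add: zero_one_polytope_def polytope_in_def)
  obtain E i j where E: "splits P E" "i \<in> E" "j \<notin> E" and ij: "i \<notin> const_coords P" "j \<notin> const_coords P"
    using decomposable_imp_splits[OF P dec] .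
  have "block P i \<in> J ` {1..k}" "block P j \<in> J ` {1..k}"
    using indecomposable_product_bij_blocks[OF prod \<open>P \<noteq> {}\<close>] ij by (simp_all add: bij_betw_def)
  then obtain a b where "a \<in> {1..k}" "b \<in> {1..k}" "block P i = J a" "block P j = J b"
    by blast
  moreover from this have "a = b"
    using \<open>\<not> k \<ge> 2\<close> by simp
  ultimately have "j \<in> block P i"
    using mem_block_self[OF ij(2)] by simp
  then show False
    using block_least[OF E(1,2)] E(3) by blast
qed

text \<open>
  By \<open>indecomposable_product_bij_blocks\<close>, two decompositions enumerate the same family of blocks, and
  \<open>zero_one_product_factor\<close> recovers the factors from the blocks as projections of \<open>P\<close>.
\<close>

theorem theorem1p1:
  fixes P :: "(real ^ 'n::finite) set"
    and J0 :: "'n set"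
    and p0 :: "real ^ 'n"
  assumes "zero_one_polytope UNIV P"
    and "J0 = const_coords P"
    and "p0 \<in> coord_space J0"
    and "\<forall>x\<in>P. \<forall>i\<in>J0. x $ i = p0 $ i"
  shows "(\<forall>i\<in>J0. p0 $ i \<in> {0, 1}) \<and>
    (\<exists>k J Q. indecomposable_product P J0 p0 k J Q \<and>
       (\<forall>k' J' Q'. indecomposable_product P J0 p0 k' J' Q' \<longrightarrow>
          (\<exists>\<sigma>. bij_betw \<sigma> {1..k'} {1..k} \<and>
               (\<forall>i\<in>{1..k'}. J' i = J (\<sigma> i) \<and> Q' i = Q (\<sigma> i))))) \<and>
    (indecomposable UNIV P \<or> (\<exists>k J Q. k \<ge> 2 \<and> zero_one_product P J0 p0 k J Q)) \<and>
    \<not> (indecomposable UNIV P \<and> (\<exists>k J Q. k \<ge> 2 \<and> zero_one_product P J0 p0 k J Q))"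
proof (intro conjI)
  have pol: "polytope_in UNIV P" and "P \<noteq> {}"
    using assms(1) by (simp_all add: zero_one_polytope_def polytope_in_def)
  show "\<forall>i\<in>J0. p0 $ i \<in> {0, 1}"
  proof
    fix i
    assume "i \<in> J0"
    have "{v. v extreme_point_of P} \<noteq> {}"
      using polytope_in_vertex_hull[OF pol] \<open>P \<noteq> {}\<close> by (metis convex_hull_eq_empty)
    then obtain v where v: "v extreme_point_of P"
      by blast
    then have "v $ i = p0 $ i"
      using assms(4) \<open>i \<in> J0\<close> by (simp add: extreme_point_of_def)
    moreover have "v $ i \<in> {0, 1}"
      using assms(1) v by (simp add: zero_one_polytope_def)
    ultimately show "p0 $ i \<in> {0, 1}"
      by simp
  qed
  have "coord_proj J0 x = p0" if "x \<in> P" for x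
    using assms(3,4) that by (auto simp: vec_eq_iff coord_proj_def coord_space_def)
  then obtain k J Q where prod: "indecomposable_product P J0 p0 k J Q"
    using indecomposable_product_exists[OF assms(1)] unfolding assms(2) by blast
  have "\<exists>\<sigma>. bij_betw \<sigma> {1..k'} {1..k} \<and> (\<forall>i\<in>{1..k'}. J' i = J (\<sigma> i) \<and> Q' i = Q (\<sigma> i))"
    if prod': "indecomposable_product P J0 p0 k' J' Q'" for k' J' Q'
  proof -
    let ?B = "block P ` (- const_coords P)"
    have J: "bij_betw J {1..k} ?B" and J': "bij_betw J' {1..k'} ?B"
      using indecomposable_product_bij_blocks \<open>P \<noteq> {}\<close> prod prod' unfolding assms(2) by blast+
    define \<sigma> where "\<sigma> = the_inv_into {1..k} J \<circ> J'"
    have \<sigma>: "bij_betw \<sigma> {1..k'} {1..k}"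
      unfolding \<sigma>_def using J' bij_betw_the_inv_into[OF J] by (rule bij_betw_trans)
    have Q_eq: "Q i = coord_proj (J i) ` P" if "i \<in> {1..k}" for i
      using prod \<open>P \<noteq> {}\<close> that unfolding indecomposable_product_def
      by (elim conjE) (rule zero_one_product_factor(2))
    have Q'_eq: "Q' i = coord_proj (J' i) ` P" if "i \<in> {1..k'}" for i
      using prod' \<open>P \<noteq> {}\<close> that unfolding indecomposable_product_def
      by (elim conjE) (rule zero_one_product_factor(2))
    have "J' i = J (\<sigma> i) \<and> Q' i = Q (\<sigma> i)" if i: "i \<in> {1..k'}" for i
    proof -
      have "J' i \<in> ?B"
        using J' i by (rule bij_betwE[THEN bspec])
      then have "J (\<sigma> i) = J' i"
        unfolding \<sigma>_def comp_def by (rule f_the_inv_into_f_bij_betw[OF J])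
      moreover have "\<sigma> i \<in> {1..k}"
        using \<sigma> i by (rule bij_betwE[THEN bspec])
      ultimately show ?thesis
        using Q_eq Q'_eq[OF i] by metis
    qed
    then show ?thesis
      using \<sigma> by blast
  qed
  then show "\<exists>k J Q. indecomposable_product P J0 p0 k J Q \<and>
      (\<forall>k' J' Q'. indecomposable_product P J0 p0 k' J' Q' \<longrightarrow>
        (\<exists>\<sigma>. bij_betw \<sigma> {1..k'} {1..k} \<and> (\<forall>i\<in>{1..k'}. J' i = J (\<sigma> i) \<and> Q' i = Q (\<sigma> i))))"
    using prod by blast
  show "indecomposable UNIV P \<or> (\<exists>k J Q. k \<ge> 2 \<and> zero_one_product P J0 p0 k J Q)"
    using decomposable_imp_two_factors[OF assms(1)] prod unfolding indecomposable_product_def assms(2) by blast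
  show "\<not> (indecomposable UNIV P \<and> (\<exists>k J Q. k \<ge> 2 \<and> zero_one_product P J0 p0 k J Q))"
    using zero_one_product_imp_decomposable[OF assms(1)] unfolding assms(2) by blast
qed

end
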